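(* Let $(\mathcal{P},\mathcal{I})$ be a projective class in a triangulated category $\mathbb{T}$, and let \[ X \xrightarrow{\alpha} Y \xrightarrow{\beta} Z \xrightarrow{\gamma} \Sigma X \] be a triangle in $\mathbb{T}$, where $X$, $Y$ and $Z$ have finite lengths $k$, $n$ and $l$, respectively, and $\gamma \in \mathcal{I}^m$ with $m \le l$. Then \[ \mathrm{len}_{\mathcal{P}}(Y) = n \ge \max(k-l+m,\,m). \]
   Context: A (stable) projective class in a triangulated category $\mathbb{T}$ consists of a class $\mathcal{P}$ of objects and a class $\mathcal{I}$ of morphisms such that: (i) $\mathcal{P}$ consists of exactly the objects $P$ such that every composite $P\to X\to Y$ is zero for each $X\to Y$ in $\mathcal{I}$; (ii) $\mathcal{I}$ consists of exactly the maps $X\to Y$ such that every composite $P\to X\to Y$ is zero for each $P\in\mathcal{P}$; (iii) for each $X$ in $\mathbb{T}$ there is a cofibre sequence (distinguished triangle) $P\to X\to Y$ with $P\in\mathcal{P}$ and $X\to Y$ in $\mathcal{I}$; and $\mathcal{P}$ (equivalently $\mathcal{I}$) is closed under suspension and desuspension. $\mathcal{I}^n$ ($n\ge 0$) is the ideal of all $n$-fold composites of maps in $\mathcal{I}$, with $\mathcal{I}^0$ all maps of $\mathbb{T}$. $\mathcal{P}_0$ consists of all zero objects, $\mathcal{P}_1=\mathcal{P}$, and $X\in\mathcal{P}_n$ iff $X$ is a retract of an object $M$ in a cofibre sequence $P\to M\to Q$ with $P\in\mathcal{P}$ and $Q\in\mathcal{P}_{n-1}$. Each $(\mathcal{P}_n,\mathcal{I}^n)$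 is a projective class. The length $\mathrm{len}_{\mathcal{P}}(X)$ is the smallest $n$ with $X\in\mathcal{P}_n$, if it exists (equivalently, the smallest $n$ such that every map in $\mathcal{I}^n$ with domain $X$ is zero). *)

theory Defs
  imports "HOL-Algebra.Group" "HOL-Library.Extended_Nat"
begin

section \<open>Categories and additive categories\<close>

record ('o, 'm) category =
  Ob :: "'o set"
  Mor :: "'m set"
  Dom :: "'m \<Rightarrow> 'o"
  Cod :: "'m \<Rightarrow> 'o"
  Ident :: "'o \<Rightarrow> 'm"
  Comp :: "'m \<Rightarrow> 'm \<Rightarrow> 'm"  (infixr \<open>\<cdot>\<index>\<close> 75)

text \<open>Composition is written in the usual order: \<open>g \<cdot> f\<close> is \<open>f\<close> followed by \<open>g\<close>.\<close>

definition Hom :: "('o, 'm, 'r) category_scheme \<Rightarrow> 'o \<Rightarrow> 'o \<Rightarrow> 'm set" where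
  "Hom C X Y = {f \<in> Mor C. Dom C f = X \<and> Cod C f = Y}"

locale category =
  fixes C :: "('o, 'm, 'r) category_scheme" (structure)
  assumes Dom_closed: "f \<in> Mor C \<Longrightarrow> Dom C f \<in> Ob C"
    and Cod_closed: "f \<in> Mor C \<Longrightarrow> Cod C f \<in> Ob C"
    and Ident_in_Hom: "X \<in> Ob C \<Longrightarrow> Ident C X \<in> Hom C X X"
    and Comp_in_Hom: "f \<in> Hom C X Y \<Longrightarrow> g \<in> Hom C Y Z \<Longrightarrow> g \<cdot> f \<in> Hom C X Z"
    and Comp_Ident_right: "f \<in> Hom C X Y \<Longrightarrow> f \<cdot> Ident C X = f"
    and Comp_Ident_left: "f \<in> Hom C X Y \<Longrightarrow> Ident C Y \<cdot> f = f"
    and Comp_assoc: "f \<in> Hom C W X \<Longrightarrow> g \<in> Hom C X Y \<Longrightarrow> h \<in> Hom C Y Z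
      \<Longrightarrow> (h \<cdot> g) \<cdot> f = h \<cdot> (g \<cdot> f)"

definition is_iso :: "('o, 'm, 'r) category_scheme \<Rightarrow> 'm \<Rightarrow> bool" where
  "is_iso C f \<longleftrightarrow> f \<in> Mor C \<and> (\<exists>g \<in> Hom C (Cod C f) (Dom C f).
     g \<cdot>\<^bsub>C\<^esub> f = Ident C (Dom C f) \<and> f \<cdot>\<^bsub>C\<^esub> g = Ident C (Cod C f))"

definition is_retract :: "('o, 'm, 'r) category_scheme \<Rightarrow> 'o \<Rightarrow> 'o \<Rightarrow> bool" where
  "is_retract C X M \<longleftrightarrow> X \<in> Ob C \<and> M \<in> Ob C \<and>
     (\<exists>i \<in> Hom C X M. \<exists>r \<in> Hom C M X. r \<cdot>\<^bsub>C\<^esub> i = Ident C X)"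

definition zero_objects :: "('o, 'm, 'r) category_scheme \<Rightarrow> 'o set" where
  "zero_objects C = {N \<in> Ob C. \<forall>X \<in> Ob C. (\<exists>!f. f \<in> Hom C X N) \<and> (\<exists>!f. f \<in> Hom C N X)}"

record ('o, 'm) preadditive = "('o, 'm) category" +
  Add :: "'m \<Rightarrow> 'm \<Rightarrow> 'm"  (infixl \<open>\<boxplus>\<index>\<close> 65)
  Zero :: "'o \<Rightarrow> 'o \<Rightarrow> 'm"

definition Hom_group :: "('o, 'm, 'r) preadditive_scheme \<Rightarrow> 'o \<Rightarrow> 'o \<Rightarrow> 'm monoid" where
  "Hom_group C X Y = \<lparr>carrier = Hom C X Y, monoid.mult = Add C, one = Zero C X Y\<rparr>"

definition Neg :: "('o, 'm, 'r) preadditive_scheme \<Rightarrow> 'm \<Rightarrow> 'm" where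
  "Neg C f = inv\<^bsub>Hom_group C (Dom C f) (Cod C f)\<^esub> f"

locale additive_category = category C
  for C :: "('o, 'm, 'r) preadditive_scheme" (structure) +
  assumes Hom_comm_group:
      "X \<in> Ob C \<Longrightarrow> Y \<in> Ob C \<Longrightarrow> comm_group (Hom_group C X Y)"
    and Comp_Add_right:
      "f \<in> Hom C X Y \<Longrightarrow> f' \<in> Hom C X Y \<Longrightarrow> g \<in> Hom C Y Z
        \<Longrightarrow> g \<cdot> (f \<boxplus> f') = (g \<cdot> f) \<boxplus> (g \<cdot> f')"
    and Comp_Add_left:
      "f \<in> Hom C X Y \<Longrightarrow> g \<in> Hom C Y Z \<Longrightarrow> g' \<in> Hom C Y Z
        \<Longrightarrow> (g \<boxplus> g') \<cdot> f = (g \<cdot> f) \<boxplus> (g' \<cdot> f)"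
    and zero_object_exists: "zero_objects C \<noteq> {}"
    and biproduct_exists:
      "X \<in> Ob C \<Longrightarrow> Y \<in> Ob C \<Longrightarrow>
        \<exists>S \<in> Ob C. \<exists>i\<^sub>1 \<in> Hom C X S. \<exists>i\<^sub>2 \<in> Hom C Y S. \<exists>p\<^sub>1 \<in> Hom C S X. \<exists>p\<^sub>2 \<in> Hom C S Y.
          p\<^sub>1 \<cdot> i\<^sub>1 = Ident C X \<and> p\<^sub>2 \<cdot> i\<^sub>2 = Ident C Y \<and>
          p\<^sub>1 \<cdot> i\<^sub>2 = Zero C Y X \<and> p\<^sub>2 \<cdot> i\<^sub>1 = Zero C X Y \<and>
          (i\<^sub>1 \<cdot> p\<^sub>1) \<boxplus> (i\<^sub>2 \<cdot> p\<^sub>2) = Ident C S"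


section \<open>Triangulated categories\<close>

text \<open>A triangle is determined by its three maps, so \<open>Dist\<close> is a set of triples of maps.\<close>

record ('o, 'm) triangulated = "('o, 'm) preadditive" +
  Susp :: "'o \<Rightarrow> 'o"
  SuspM :: "'m \<Rightarrow> 'm"
  Dist :: "('m \<times> 'm \<times> 'm) set"

definition is_triangle :: "('o, 'm, 'r) triangulated_scheme \<Rightarrow> 'm \<Rightarrow> 'm \<Rightarrow> 'm \<Rightarrow> bool" where
  "is_triangle T f g h \<longleftrightarrow> f \<in> Mor T \<and> g \<in> Mor T \<and> h \<in> Mor T \<and>
     Cod T f = Dom T g \<and> Cod T g = Dom T h \<and> Cod T h = Susp T (Dom T f)"

text \<open>
  The suspension is only required to be an additive self-equivalence (a fully faithful and
  essentially surjective additive functor), not a strict automorphism.  The distinguished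
  triangles satisfy Verdier's axioms, including the octahedral axiom.
\<close>

locale triangulated_category = additive_category T
  for T :: "('o, 'm, 'r) triangulated_scheme" (structure) +
  assumes Susp_closed: "X \<in> Ob T \<Longrightarrow> Susp T X \<in> Ob T"
    and SuspM_Ident: "X \<in> Ob T \<Longrightarrow> SuspM T (Ident T X) = Ident T (Susp T X)"
    and SuspM_Comp: "f \<in> Hom T X Y \<Longrightarrow> g \<in> Hom T Y Z
      \<Longrightarrow> SuspM T (g \<cdot> f) = SuspM T g \<cdot> SuspM T f"
    and SuspM_Add: "f \<in> Hom T X Y \<Longrightarrow> g \<in> Hom T X Y
      \<Longrightarrow> SuspM T (f \<boxplus> g) = SuspM T f \<boxplus> SuspM T g"
    and SuspM_fully_faithful: "X \<in> Ob T \<Longrightarrow> Y \<in> Ob T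
      \<Longrightarrow> bij_betw (SuspM T) (Hom T X Y) (Hom T (Susp T X) (Susp T Y))"
    and Susp_essentially_surjective: "Y \<in> Ob T
      \<Longrightarrow> \<exists>X \<in> Ob T. \<exists>e \<in> Hom T (Susp T X) Y. is_iso T e"
    and Dist_is_triangle: "(f, g, h) \<in> Dist T \<Longrightarrow> is_triangle T f g h"
    and TR1_iso:
      "(f, g, h) \<in> Dist T \<Longrightarrow> is_triangle T f' g' h'
        \<Longrightarrow> a \<in> Hom T (Dom T f) (Dom T f') \<Longrightarrow> b \<in> Hom T (Dom T g) (Dom T g')
        \<Longrightarrow> c \<in> Hom T (Dom T h) (Dom T h')
        \<Longrightarrow> is_iso T a \<Longrightarrow> is_iso T b \<Longrightarrow> is_iso T c
        \<Longrightarrow> b \<cdot> f = f' \<cdot> a \<Longrightarrow> c \<cdot> g = g' \<cdot> b \<Longrightarrow> SuspM T a \<cdot> h = h' \<cdot> c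
        \<Longrightarrow> (f', g', h') \<in> Dist T"
    and TR1_Ident:
      "X \<in> Ob T \<Longrightarrow> N \<in> zero_objects T
        \<Longrightarrow> (Ident T X, Zero T X N, Zero T N (Susp T X)) \<in> Dist T"
    and TR1_complete:
      "f \<in> Mor T \<Longrightarrow> \<exists>g h. (f, g, h) \<in> Dist T"
    and TR2:
      "is_triangle T f g h
        \<Longrightarrow> (f, g, h) \<in> Dist T \<longleftrightarrow> (g, h, Neg T (SuspM T f)) \<in> Dist T"
    and TR3:
      "(f, g, h) \<in> Dist T \<Longrightarrow> (f', g', h') \<in> Dist T
        \<Longrightarrow> a \<in> Hom T (Dom T f) (Dom T f') \<Longrightarrow> b \<in> Hom T (Dom T g) (Dom T g')
        \<Longrightarrow> b \<cdot> f = f' \<cdot> a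
        \<Longrightarrow> \<exists>c \<in> Hom T (Dom T h) (Dom T h'). c \<cdot> g = g' \<cdot> b \<and> SuspM T a \<cdot> h = h' \<cdot> c"
    and TR4:
      "f \<in> Hom T X Y \<Longrightarrow> g \<in> Hom T Y Z
        \<Longrightarrow> (f, j\<^sub>1, k\<^sub>1) \<in> Dist T \<Longrightarrow> (g, j\<^sub>2, k\<^sub>2) \<in> Dist T \<Longrightarrow> (g \<cdot> f, j\<^sub>3, k\<^sub>3) \<in> Dist T
        \<Longrightarrow> \<exists>u \<in> Hom T (Dom T k\<^sub>1) (Dom T k\<^sub>3). \<exists>v \<in> Hom T (Dom T k\<^sub>3) (Dom T k\<^sub>2).
              (u, v, SuspM T j\<^sub>1 \<cdot> k\<^sub>2) \<in> Dist T \<and>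
              u \<cdot> j\<^sub>1 = j\<^sub>3 \<cdot> g \<and> k\<^sub>3 \<cdot> u = k\<^sub>1 \<and> v \<cdot> j\<^sub>3 = j\<^sub>2 \<and> k\<^sub>2 \<cdot> v = SuspM T f \<cdot> k\<^sub>3"

definition cofibre_sequence :: "('o, 'm, 'r) triangulated_scheme \<Rightarrow> 'm \<Rightarrow> 'm \<Rightarrow> bool" where
  "cofibre_sequence T f g \<longleftrightarrow> (\<exists>h. (f, g, h) \<in> Dist T)"


section \<open>Projective classes and lengths\<close>

text \<open>
  Stability is required of \<open>\<P>\<close>, from which it follows for \<open>\<I>\<close>.  As there is no chosen
  inverse of the suspension, closure under desuspension says that an object whose suspension
  lies in \<open>\<P>\<close> lies in \<open>\<P>\<close>.
\<close>

locale projective_class = triangulated_category T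
  for T :: "('o, 'm, 'r) triangulated_scheme" (structure) and \<P> :: "'o set" and \<I> :: "'m set" +
  assumes proj_iff:
      "P \<in> \<P> \<longleftrightarrow> P \<in> Ob T \<and>
        (\<forall>f \<in> \<I>. \<forall>p \<in> Hom T P (Dom T f). f \<cdot> p = Zero T P (Cod T f))"
    and ideal_iff:
      "f \<in> \<I> \<longleftrightarrow> f \<in> Mor T \<and>
        (\<forall>P \<in> \<P>. \<forall>p \<in> Hom T P (Dom T f). f \<cdot> p = Zero T P (Cod T f))"
    and enough_projectives:
      "X \<in> Ob T \<Longrightarrow> \<exists>P \<in> \<P>. \<exists>p \<in> Hom T P X. \<exists>f \<in> \<I>. cofibre_sequence T p f"
    and Susp_closed_proj: "P \<in> \<P> \<Longrightarrow> Susp T P \<in> \<P>"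
    and desuspension_closed_proj: "X \<in> Ob T \<Longrightarrow> Susp T X \<in> \<P> \<Longrightarrow> X \<in> \<P>"

fun ideal_power :: "('o, 'm, 'r) triangulated_scheme \<Rightarrow> 'm set \<Rightarrow> nat \<Rightarrow> 'm set" where
  "ideal_power T \<I> 0 = Mor T"
| "ideal_power T \<I> (Suc 0) = \<I>"
| "ideal_power T \<I> (Suc (Suc n)) =
     {g \<cdot>\<^bsub>T\<^esub> f | f g. f \<in> ideal_power T \<I> (Suc n) \<and> g \<in> \<I> \<and> Cod T f = Dom T g}"

fun proj_power :: "('o, 'm, 'r) triangulated_scheme \<Rightarrow> 'o set \<Rightarrow> nat \<Rightarrow> 'o set" where
  "proj_power T \<P> 0 = zero_objects T"
| "proj_power T \<P> (Suc 0) = \<P>"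
| "proj_power T \<P> (Suc (Suc n)) =
     {X. \<exists>M. is_retract T X M \<and>
       (\<exists>P \<in> \<P>. \<exists>Q \<in> proj_power T \<P> (Suc n). \<exists>f \<in> Hom T P M. \<exists>g \<in> Hom T M Q.
          cofibre_sequence T f g)}"

definition len :: "('o, 'm, 'r) triangulated_scheme \<Rightarrow> 'o set \<Rightarrow> 'o \<Rightarrow> enat" where
  "len T \<P> X = (if \<exists>n. X \<in> proj_power T \<P> n then enat (LEAST n. X \<in> proj_power T \<P> n) else \<infinity>)"

end

theory Submission imports Defs begin

text \<open>
  Everything rests on one characterisation of length: \<open>X\<close> lies in \<open>\<P>\<^sub>n\<close> exactly when every map
  in \<open>\<I>\<^sup>n\<close> with domain \<open>X\<close> is zero (\<open>proj_power_iff_annihilated\<close>). The forward direction is the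
  ghost lemma. For the converse, every \<open>X\<close> receives a map \<open>q\<close> from some \<open>W \<in> \<P>\<^sub>n\<close> such that all
  maps killing \<open>q\<close> lie in \<open>\<I>\<^sup>n\<close> (\<open>proj_approximation\<close>); if \<open>\<I>\<^sup>n\<close> vanishes on \<open>X\<close>, then the map
  from \<open>X\<close> to the cone of \<open>q\<close> is zero and \<open>X\<close> is a retract of \<open>W\<close>.

  The inequality \<open>n \<ge> m\<close> (\<open>connecting_map_power_le_middle_length\<close>). Suppose \<open>n < m\<close>. A map in
  \<open>\<I>\<^sup>n\<close> out of \<open>Z\<close> restricts to zero on \<open>Y\<close>, hence factors through \<open>\<gamma>\<close> and lies in \<open>\<I>\<^sup>m\<close>, so in
  \<open>\<I>\<^sup>n\<^sup>+\<^sup>1\<close>. Since powers of \<open>\<I>\<close> can be split, this improvement repeats indefinitely: such a map lies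
  in \<open>\<I>\<^sup>l\<close> and is zero. Thus \<open>l \<le> n < m\<close>, contradicting \<open>m \<le> l\<close>.

  The inequality \<open>k \<le> (l - m) + n\<close> (\<open>first_length_le\<close>). Write a map out of \<open>X\<close> in
  \<open>\<I>\<close> to the power \<open>(l - m) + n\<close> as \<open>b \<cdot> a\<close> with \<open>a\<close> in the power \<open>l - m\<close> and \<open>b\<close> in the
  power \<open>n\<close>. By stability \<open>\<Sigma>a \<cdot> \<gamma>\<close> lies in \<open>\<I>\<^sup>l\<close>, so it vanishes on \<open>Z\<close>, and \<open>a\<close> extends over
  \<open>\<alpha>\<close> to a map \<open>v\<close> out of \<open>Y\<close>. Then \<open>b \<cdot> v\<close> lies in \<open>\<I>\<^sup>n\<close> on \<open>Y\<close> and is zero, so \<open>b \<cdot> a = 0\<close>.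
\<close>

section \<open>Additive categories\<close>

context category
begin

lemma Hom_Ob: "f \<in> Hom C X Y \<Longrightarrow> X \<in> Ob C" "f \<in> Hom C X Y \<Longrightarrow> Y \<in> Ob C"
  using Dom_closed Cod_closed by (auto simp: Hom_def)

lemma Hom_Mor: "f \<in> Hom C X Y \<Longrightarrow> f \<in> Mor C"
  by (simp add: Hom_def)

lemma Hom_Dom: "f \<in> Hom C X Y \<Longrightarrow> Dom C f = X"
  by (simp add: Hom_def)

lemma Hom_Cod: "f \<in> Hom C X Y \<Longrightarrow> Cod C f = Y"
  by (simp add: Hom_def)

lemma Mor_in_Hom: "f \<in> Mor C \<Longrightarrow> f \<in> Hom C (Dom C f) (Cod C f)"
  by (simp add: Hom_def)

lemma Ident_is_iso: "X \<in> Ob C \<Longrightarrow> is_iso C (Ident C X)"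
  unfolding is_iso_def
  by (metis Comp_Ident_left Hom_Cod Hom_Dom Hom_Mor Ident_in_Hom)

lemma is_retract_refl: "X \<in> Ob C \<Longrightarrow> is_retract C X X"
  unfolding is_retract_def by (metis Comp_Ident_left Ident_in_Hom)

lemma is_retract_trans:
  assumes "is_retract C X Y" "is_retract C Y Z"
  shows "is_retract C X Z"
proof -
  obtain i r where ir: "i \<in> Hom C X Y" "r \<in> Hom C Y X" "r \<cdot> i = Ident C X"
    using assms(1) by (auto simp: is_retract_def)
  obtain i' r' where ir': "i' \<in> Hom C Y Z" "r' \<in> Hom C Z Y" "r' \<cdot> i' = Ident C Y"
    using assms(2) by (auto simp: is_retract_def)
  have "r' \<cdot> (i' \<cdot> i) = i"
    using Comp_assoc[OF ir(1) ir'(1,2)] ir'(3) Comp_Ident_left[OF ir(1)] by simp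
  then have "(r \<cdot> r') \<cdot> (i' \<cdot> i) = Ident C X"
    using Comp_assoc[OF Comp_in_Hom[OF ir(1) ir'(1)] ir'(2) ir(2)] ir(3) by simp
  then show ?thesis
    unfolding is_retract_def
    using Comp_in_Hom[OF ir(1) ir'(1)] Comp_in_Hom[OF ir'(2) ir(2)] Hom_Ob by metis
qed

end

context additive_category
begin

lemma Zero_in_Hom: "X \<in> Ob C \<Longrightarrow> Y \<in> Ob C \<Longrightarrow> Zero C X Y \<in> Hom C X Y"
  using monoid.one_closed[of "Hom_group C X Y"] Hom_comm_group[of X Y]
  by (simp add: Hom_group_def comm_group_def group_def)

lemma Add_in_Hom:
  assumes "f \<in> Hom C X Y" "g \<in> Hom C X Y"
  shows "f \<boxplus> g \<in> Hom C X Y"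
proof -
  interpret G: comm_group "Hom_group C X Y"
    using Hom_comm_group Hom_Ob[OF assms(1)] by blast
  show ?thesis using G.m_closed assms by (simp add: Hom_group_def)
qed

lemma Add_Zero:
  assumes "f \<in> Hom C X Y"
  shows "f \<boxplus> Zero C X Y = f" "Zero C X Y \<boxplus> f = f"
proof -
  interpret G: comm_group "Hom_group C X Y"
    using Hom_comm_group Hom_Ob[OF assms(1)] by blast
  show "f \<boxplus> Zero C X Y = f" "Zero C X Y \<boxplus> f = f"
    using G.r_one[of f] G.l_one[of f] assms by (simp_all add: Hom_group_def)
qed

lemma Add_assoc:
  assumes "f \<in> Hom C X Y" "g \<in> Hom C X Y" "h \<in> Hom C X Y"
  shows "(f \<boxplus> g) \<boxplus> h = f \<boxplus> (g \<boxplus> h)"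
proof -
  interpret G: comm_group "Hom_group C X Y"
    using Hom_comm_group Hom_Ob[OF assms(1)] by blast
  show ?thesis using G.m_assoc[of f g h] assms by (simp add: Hom_group_def)
qed

lemma Add_commute:
  assumes "f \<in> Hom C X Y" "g \<in> Hom C X Y"
  shows "f \<boxplus> g = g \<boxplus> f"
proof -
  interpret G: comm_group "Hom_group C X Y"
    using Hom_comm_group Hom_Ob[OF assms(1)] by blast
  show ?thesis using G.m_comm[of f g] assms by (simp add: Hom_group_def)
qed

lemma Neg_in_Hom: "f \<in> Hom C X Y \<Longrightarrow> Neg C f \<in> Hom C X Y"
  and Add_Neg: "f \<in> Hom C X Y \<Longrightarrow> f \<boxplus> Neg C f = Zero C X Y"
proof -
  assume f: "f \<in> Hom C X Y"
  interpret G: comm_group "Hom_group C X Y"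
    using Hom_comm_group Hom_Ob[OF f] by blast
  have N: "Neg C f = inv\<^bsub>Hom_group C X Y\<^esub> f"
    using f by (simp add: Neg_def Hom_def)
  show "Neg C f \<in> Hom C X Y" "f \<boxplus> Neg C f = Zero C X Y"
    using G.inv_closed[of f] G.r_inv[of f] f unfolding N by (auto simp: Hom_group_def)
qed

lemma Neg_unique:
  assumes "f \<in> Hom C X Y" "g \<in> Hom C X Y" "f \<boxplus> g = Zero C X Y"
  shows "g = Neg C f"
proof -
  have N: "Neg C f \<in> Hom C X Y" using assms(1) by (rule Neg_in_Hom)
  have "g = (Neg C f \<boxplus> f) \<boxplus> g"
    using Add_Neg[OF assms(1)] Add_commute[OF N assms(1)] Add_Zero[OF assms(2)] by simp
  also have "\<dots> = Neg C f"
    using Add_assoc[OF N assms(1,2)] assms(3) Add_Zero[OF N] by simp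
  finally show ?thesis .
qed

lemma Neg_Neg:
  assumes "f \<in> Hom C X Y"
  shows "Neg C (Neg C f) = f"
proof -
  have N: "Neg C f \<in> Hom C X Y" using assms by (rule Neg_in_Hom)
  show ?thesis
    using Neg_unique[OF N assms] Add_Neg[OF assms] Add_commute[OF N assms] by simp
qed

lemma Neg_Zero:
  assumes "X \<in> Ob C" "Y \<in> Ob C"
  shows "Neg C (Zero C X Y) = Zero C X Y"
  using Neg_unique[of "Zero C X Y" X Y "Zero C X Y"] Zero_in_Hom[OF assms] Add_Zero by metis

lemma Zero_if_Add_self:
  assumes "f \<in> Hom C X Y" "f \<boxplus> f = f"
  shows "f = Zero C X Y"
proof -
  have N: "Neg C f \<in> Hom C X Y" using assms(1) by (rule Neg_in_Hom)
  have "f = f \<boxplus> (f \<boxplus> Neg C f)"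
    using Add_Neg[OF assms(1)] Add_Zero[OF assms(1)] by simp
  also have "\<dots> = Zero C X Y"
    using Add_assoc[OF assms(1,1) N] assms(2) Add_Neg[OF assms(1)] by simp
  finally show ?thesis .
qed

lemma Comp_Zero_right:
  assumes "g \<in> Hom C Y Z" "X \<in> Ob C"
  shows "g \<cdot> Zero C X Y = Zero C X Z"
proof -
  have Z: "Zero C X Y \<in> Hom C X Y" using Zero_in_Hom assms Hom_Ob by blast
  show ?thesis
    using Zero_if_Add_self[OF Comp_in_Hom[OF Z assms(1)]] Comp_Add_right[OF Z Z assms(1)] Add_Zero[OF Z]
    by simp
qed

lemma Comp_Zero_left:
  assumes "f \<in> Hom C X Y" "Z \<in> Ob C"
  shows "Zero C Y Z \<cdot> f = Zero C X Z"
proof -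
  have Z: "Zero C Y Z \<in> Hom C Y Z" using Zero_in_Hom assms Hom_Ob by blast
  show ?thesis
    using Zero_if_Add_self[OF Comp_in_Hom[OF assms(1) Z]] Comp_Add_left[OF assms(1) Z Z] Add_Zero[OF Z]
    by simp
qed

lemma Comp_Neg_right:
  assumes "f \<in> Hom C X Y" "g \<in> Hom C Y Z"
  shows "g \<cdot> Neg C f = Neg C (g \<cdot> f)"
proof (rule Neg_unique)
  have N: "Neg C f \<in> Hom C X Y" using assms(1) by (rule Neg_in_Hom)
  show "g \<cdot> f \<in> Hom C X Z" "g \<cdot> Neg C f \<in> Hom C X Z"
    using assms N Comp_in_Hom by blast+
  show "g \<cdot> f \<boxplus> g \<cdot> Neg C f = Zero C X Z"
    using Comp_Add_right[OF assms(1) N assms(2)] Add_Neg[OF assms(1)]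
      Comp_Zero_right[OF assms(2)] Hom_Ob[OF assms(1)] by simp
qed

lemma Comp_Neg_left:
  assumes "f \<in> Hom C X Y" "g \<in> Hom C Y Z"
  shows "Neg C g \<cdot> f = Neg C (g \<cdot> f)"
proof (rule Neg_unique)
  have N: "Neg C g \<in> Hom C Y Z" using assms(2) by (rule Neg_in_Hom)
  show "g \<cdot> f \<in> Hom C X Z" "Neg C g \<cdot> f \<in> Hom C X Z"
    using assms N Comp_in_Hom by blast+
  show "g \<cdot> f \<boxplus> Neg C g \<cdot> f = Zero C X Z"
    using Comp_Add_left[OF assms(1) assms(2) N] Add_Neg[OF assms(2)]
      Comp_Zero_left[OF assms(1)] Hom_Ob[OF assms(2)] by simp
qed

lemma Neg_eq_iff:
  assumes "f \<in> Hom C X Y" "g \<in> Hom C X Y"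
  shows "Neg C f = Neg C g \<longleftrightarrow> f = g"
  using Neg_Neg assms by metis

lemma diff_Comp_Zero:
  assumes "f \<in> Hom C X Y" "g \<in> Hom C Y Z" "g' \<in> Hom C Y Z" "g \<cdot> f = g' \<cdot> f"
  shows "(g \<boxplus> Neg C g') \<cdot> f = Zero C X Z"
  using Comp_Add_left[OF assms(1,2) Neg_in_Hom[OF assms(3)]]
    Comp_Neg_left[OF assms(1,3)] Add_Neg[OF Comp_in_Hom[OF assms(1,3)]] assms(4)
  by simp

lemma zero_objects_iff:
  "N \<in> zero_objects C \<longleftrightarrow> N \<in> Ob C \<and> Ident C N = Zero C N N"
proof safe
  assume N: "N \<in> zero_objects C"
  show "N \<in> Ob C" using N by (simp add: zero_objects_def)
  then show "Ident C N = Zero C N N"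
    using N Ident_in_Hom Zero_in_Hom unfolding zero_objects_def by blast
next
  assume N: "N \<in> Ob C" and I: "Ident C N = Zero C N N"
  have "f = Zero C X N" if "X \<in> Ob C" "f \<in> Hom C X N" for X f
    using Comp_Ident_left[OF that(2)] Comp_Zero_left[OF that(2) N] I by simp
  moreover have "f = Zero C N X" if "X \<in> Ob C" "f \<in> Hom C N X" for X f
    using Comp_Ident_right[OF that(2)] Comp_Zero_right[OF that(2) N] I by simp
  ultimately show "N \<in> zero_objects C"
    unfolding zero_objects_def using Zero_in_Hom N by blast
qed

lemma Hom_from_zero_object:
  assumes "N \<in> zero_objects C" "f \<in> Hom C N X"
  shows "f = Zero C N X"
  using Comp_Ident_right[OF assms(2)] Comp_Zero_right[OF assms(2)] assms(1) zero_objects_iff by simp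

end

section \<open>Exactness of triangles\<close>

context triangulated_category
begin

lemma SuspM_in_Hom:
  assumes "f \<in> Hom T X Y"
  shows "SuspM T f \<in> Hom T (Susp T X) (Susp T Y)"
  using SuspM_fully_faithful[OF Hom_Ob[OF assms]] assms bij_betwE by blast

lemma SuspM_faithful:
  assumes "f \<in> Hom T X Y" "g \<in> Hom T X Y" "SuspM T f = SuspM T g"
  shows "f = g"
  using SuspM_fully_faithful[OF Hom_Ob[OF assms(1)]] assms by (auto simp: bij_betw_def inj_on_def)

lemma SuspM_full:
  assumes "X \<in> Ob T" "Y \<in> Ob T" "g \<in> Hom T (Susp T X) (Susp T Y)"
  obtains f where "f \<in> Hom T X Y" "SuspM T f = g"
  using bij_betw_imp_surj_on[OF SuspM_fully_faithful[OF assms(1,2)]] assms(3) that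
  by (metis imageE)

lemma SuspM_Zero:
  assumes "X \<in> Ob T" "Y \<in> Ob T"
  shows "SuspM T (Zero T X Y) = Zero T (Susp T X) (Susp T Y)"
  using Zero_if_Add_self SuspM_in_Hom SuspM_Add Zero_in_Hom[OF assms] Add_Zero by metis

lemma SuspM_Neg:
  assumes "f \<in> Hom T X Y"
  shows "SuspM T (Neg T f) = Neg T (SuspM T f)"
  using Neg_unique[OF SuspM_in_Hom[OF assms] SuspM_in_Hom[OF Neg_in_Hom[OF assms]]]
    SuspM_Add[OF assms Neg_in_Hom[OF assms]] Add_Neg[OF assms] SuspM_Zero[OF Hom_Ob[OF assms]]
  by simp

lemma Susp_zero_object:
  assumes "N \<in> zero_objects T"
  shows "Susp T N \<in> zero_objects T"
  using assms Susp_closed SuspM_Ident SuspM_Zero by (auto simp: zero_objects_iff) metis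

lemma is_triangleI:
  "f \<in> Hom T A B \<Longrightarrow> g \<in> Hom T B D \<Longrightarrow> h \<in> Hom T D (Susp T A) \<Longrightarrow> is_triangle T f g h"
  by (simp add: is_triangle_def Hom_def)

lemma Dist_Hom3:
  assumes "(f, g, h) \<in> Dist T" "f \<in> Hom T A B" "g \<in> Hom T B D"
  shows "h \<in> Hom T D (Susp T A)"
  using Dist_is_triangle[OF assms(1)] assms(2,3) by (auto simp: is_triangle_def Hom_def)

lemma Dist_rotate: "(f, g, h) \<in> Dist T \<Longrightarrow> (g, h, Neg T (SuspM T f)) \<in> Dist T"
  using TR2 Dist_is_triangle by blast

lemma TR3_Hom:
  assumes "(f, g, h) \<in> Dist T" "f \<in> Hom T A B" "g \<in> Hom T B D"
    and "(f', g', h') \<in> Dist T" "f' \<in> Hom T A' B'" "g' \<in> Hom T B' D'"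
    and "a \<in> Hom T A A'" "b \<in> Hom T B B'" "b \<cdot> f = f' \<cdot> a"
  obtains c where "c \<in> Hom T D D'" "c \<cdot> g = g' \<cdot> b" "SuspM T a \<cdot> h = h' \<cdot> c"
proof -
  have h: "h \<in> Hom T D (Susp T A)" "h' \<in> Hom T D' (Susp T A')"
    using assms Dist_Hom3 by blast+
  show ?thesis
    using TR3[OF assms(1,4), of a b] assms h that by (auto simp: Hom_def)
qed

text \<open>The composite factors through a zero object, by mapping the triangle on the identity of \<open>A\<close>
  to the given one.\<close>

lemma Dist_Comp_Zero:
  assumes "(f, g, h) \<in> Dist T" "f \<in> Hom T A B" "g \<in> Hom T B D"
  shows "g \<cdot> f = Zero T A D"
proof -
  obtain N where N: "N \<in> zero_objects T" using zero_object_exists by blast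
  have NO: "N \<in> Ob T" using N zero_objects_iff by blast
  have A: "A \<in> Ob T" using assms Hom_Ob by blast
  have z: "Zero T A N \<in> Hom T A N" using Zero_in_Hom A NO by blast
  obtain c where c: "c \<in> Hom T N D" "c \<cdot> Zero T A N = g \<cdot> f"
    using TR3_Hom[OF TR1_Ident[OF A N] Ident_in_Hom[OF A] z assms Ident_in_Hom[OF A] assms(2)]
    by metis
  then show ?thesis using Comp_Zero_right[OF c(1) A] by simp
qed

text \<open>The triangle \<open>0 \<rightarrow> V \<rightarrow> V \<rightarrow> 0\<close> arises by rotating the one on the identity of \<open>V\<close> backwards;
  its last vertex has to be the suspension of its first one.\<close>

lemma Dist_Ident_middle:
  assumes "V \<in> Ob T" "N \<in> zero_objects T"
  shows "(Zero T N V, Ident T V, Zero T V (Susp T N)) \<in> Dist T"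
proof -
  have N: "N \<in> Ob T" using assms(2) zero_objects_iff by blast
  have S: "Susp T N \<in> zero_objects T" using assms(2) by (rule Susp_zero_object)
  have SN: "Susp T N \<in> Ob T" "Susp T V \<in> Ob T" using N assms(1) Susp_closed by blast+
  have tri: "is_triangle T (Zero T N V) (Ident T V) (Zero T V (Susp T N))"
    using is_triangleI Zero_in_Hom Ident_in_Hom N SN assms(1) by metis
  have "(Ident T V, Zero T V (Susp T N), Neg T (SuspM T (Zero T N V))) \<in> Dist T"
    using TR1_Ident[OF assms(1) S] SuspM_Zero[OF N assms(1)] Neg_Zero[OF SN] by simp
  then show ?thesis using TR2[OF tri] by simp
qed

text \<open>A map that kills \<open>f\<close> is the middle component of a map from the triangle to
  \<open>0 \<rightarrow> V \<rightarrow> V \<rightarrow> 0\<close>, whose third component is the factorisation.\<close>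

lemma weak_cokernel:
  assumes "(f, g, h) \<in> Dist T" "f \<in> Hom T A B" "g \<in> Hom T B D"
    and "u \<in> Hom T B V" "u \<cdot> f = Zero T A V"
  obtains u' where "u' \<in> Hom T D V" "u' \<cdot> g = u"
proof -
  obtain N where N: "N \<in> zero_objects T" using zero_object_exists by blast
  have NO: "N \<in> Ob T" using N zero_objects_iff by blast
  have A: "A \<in> Ob T" using assms Hom_Ob by blast
  have V: "V \<in> Ob T" using assms Hom_Ob by blast
  have z: "Zero T N V \<in> Hom T N V" "Zero T A N \<in> Hom T A N" using Zero_in_Hom A V NO by blast+
  have "u \<cdot> f = Zero T N V \<cdot> Zero T A N" using assms(5) Comp_Zero_right[OF z(1) A] by simp
  then obtain c where "c \<in> Hom T D V" "c \<cdot> g = Ident T V \<cdot> u"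
    using TR3_Hom[OF assms(1-3) Dist_Ident_middle[OF V N] z(1) Ident_in_Hom[OF V] z(2) assms(4)]
    by metis
  then show ?thesis using that Comp_Ident_left[OF assms(4)] by simp
qed

lemma weak_cokernel_rotated:
  assumes "(f, g, h) \<in> Dist T" "f \<in> Hom T A B" "g \<in> Hom T B D"
    and "u \<in> Hom T D V" "u \<cdot> g = Zero T B V"
  obtains u' where "u' \<in> Hom T (Susp T A) V" "u' \<cdot> h = u"
  using weak_cokernel[OF Dist_rotate[OF assms(1)] assms(3) Dist_Hom3[OF assms(1-3)] assms(4,5)] .

text \<open>The axiom on maps of triangles only supplies a third component. So the triangle
  \<open>W \<rightarrow> W \<rightarrow> 0\<close> on the identity of \<open>W\<close> and the given triangle are both rotated once, which makes the
  suspension of the wanted map \<open>W \<rightarrow> A\<close> a third component.\<close>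

lemma weak_kernel:
  assumes "(f, g, h) \<in> Dist T" "f \<in> Hom T A B" "g \<in> Hom T B D"
    and "s \<in> Hom T W B" "g \<cdot> s = Zero T W D"
  obtains w where "w \<in> Hom T W A" "f \<cdot> w = s"
proof -
  obtain N where N: "N \<in> zero_objects T" using zero_object_exists by blast
  have NO: "N \<in> Ob T" using N zero_objects_iff by blast
  have O: "W \<in> Ob T" "A \<in> Ob T" "B \<in> Ob T" "D \<in> Ob T" using assms Hom_Ob by blast+
  have SO: "Susp T W \<in> Ob T" using O Susp_closed by blast
  have z: "Zero T W N \<in> Hom T W N" "Zero T N (Susp T W) \<in> Hom T N (Susp T W)"
    "Zero T N D \<in> Hom T N D" using Zero_in_Hom O SO NO by blast+
  have e: "Zero T N D \<cdot> Zero T W N = g \<cdot> s" using assms(5) Comp_Zero_right[OF z(3) O(1)] by simp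
  obtain c where c: "c \<in> Hom T (Susp T W) (Susp T A)"
    "SuspM T s \<cdot> Neg T (SuspM T (Ident T W)) = Neg T (SuspM T f) \<cdot> c"
    using TR3_Hom[OF Dist_rotate[OF TR1_Ident[OF O(1) N]] z(1,2) Dist_rotate[OF assms(1)] assms(3)
        Dist_Hom3[OF assms(1-3)] assms(4) z(3) e] by metis
  obtain w where w: "w \<in> Hom T W A" "SuspM T w = c" using SuspM_full[OF O(1,2) c(1)] .
  have S: "SuspM T s \<in> Hom T (Susp T W) (Susp T B)" using assms(4) by (rule SuspM_in_Hom)
  have F: "SuspM T f \<in> Hom T (Susp T A) (Susp T B)" using assms(2) by (rule SuspM_in_Hom)
  have "Neg T (SuspM T s) = Neg T (SuspM T f \<cdot> c)"
    using c(2) SuspM_Ident[OF O(1)] Comp_Neg_right[OF Ident_in_Hom[OF SO] S] Comp_Ident_right[OF S]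
      Comp_Neg_left[OF c(1) F] by simp
  then have "SuspM T s = SuspM T (f \<cdot> w)"
    using Neg_eq_iff[OF S Comp_in_Hom[OF c(1) F]] SuspM_Comp[OF w(1) assms(2)] w(2) by simp
  then show ?thesis using that w(1) SuspM_faithful[OF assms(4) Comp_in_Hom[OF w(1) assms(2)]] by simp
qed

text \<open>After two rotations the suspension of \<open>u\<close> factors through the suspension of \<open>f\<close>; fullness
  and faithfulness of the suspension remove it again.\<close>

lemma weak_cokernel_desuspended:
  assumes "(f, g, h) \<in> Dist T" "f \<in> Hom T A B" "g \<in> Hom T B D"
    and "u \<in> Hom T A V" "SuspM T u \<cdot> h = Zero T D (Susp T V)"
  obtains u' where "u' \<in> Hom T B V" "u' \<cdot> f = u"
proof -
  note h = Dist_Hom3[OF assms(1-3)]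
  have O: "A \<in> Ob T" "B \<in> Ob T" "V \<in> Ob T" using assms Hom_Ob by blast+
  have F: "SuspM T f \<in> Hom T (Susp T A) (Susp T B)" using assms(2) by (rule SuspM_in_Hom)
  obtain c where c: "c \<in> Hom T (Susp T B) (Susp T V)" "c \<cdot> Neg T (SuspM T f) = SuspM T u"
    using weak_cokernel_rotated[OF Dist_rotate[OF assms(1)] assms(3) h SuspM_in_Hom[OF assms(4)] assms(5)] .
  obtain v where v: "v \<in> Hom T B V" "SuspM T v = c" using SuspM_full[OF O(2,3) c(1)] .
  have "SuspM T (Neg T v \<cdot> f) = SuspM T u"
    using SuspM_Comp[OF assms(2) Neg_in_Hom[OF v(1)]] SuspM_Neg[OF v(1)] v(2)
      Comp_Neg_left[OF F c(1)] Comp_Neg_right[OF F c(1)] c(2) by simp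
  then have "Neg T v \<cdot> f = u"
    using SuspM_faithful Comp_in_Hom[OF assms(2) Neg_in_Hom[OF v(1)]] assms(4) by blast
  then show ?thesis using that Neg_in_Hom[OF v(1)] by blast
qed

text \<open>The cone of \<open>h\<close> is isomorphic to a suspension \<open>\<Sigma>M\<close>; transporting the triangle on \<open>h\<close>
  along such an isomorphism and rotating backwards twice, which costs one sign for each of the two
  new maps, gives the required triangle.\<close>

lemma complete_third_map:
  assumes "h \<in> Hom T Q (Susp T P)" "P \<in> Ob T"
  obtains M f g where "f \<in> Hom T P M" "g \<in> Hom T M Q" "(f, g, h) \<in> Dist T"
proof -
  obtain a b where D: "(h, a, b) \<in> Dist T" using TR1_complete Hom_Mor[OF assms(1)] by blast
  obtain D' where ab: "a \<in> Hom T (Susp T P) D'" "b \<in> Hom T D' (Susp T Q)"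
    using Dist_is_triangle[OF D] assms(1) by (auto simp: is_triangle_def Hom_def)
  have O: "Q \<in> Ob T" "Susp T P \<in> Ob T" "D' \<in> Ob T" "Susp T Q \<in> Ob T"
    using assms ab Hom_Ob by blast+
  obtain M e where M: "M \<in> Ob T" and e: "e \<in> Hom T (Susp T M) D'" "is_iso T e"
    using Susp_essentially_surjective[OF O(3)] by blast
  obtain e' where e': "e' \<in> Hom T D' (Susp T M)" "e' \<cdot> e = Ident T (Susp T M)" "e \<cdot> e' = Ident T D'"
    using e unfolding is_iso_def by (auto simp: Hom_Dom[OF e(1)] Hom_Cod[OF e(1)])
  have iso: "is_iso T e'"
    unfolding is_iso_def using e e' by (auto simp: Hom_Dom[OF e'(1)] Hom_Cod[OF e'(1)] Hom_Mor)
  obtain f where f: "f \<in> Hom T P M" "SuspM T f = e' \<cdot> a"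
    using SuspM_full[OF assms(2) M Comp_in_Hom[OF ab(1) e'(1)]] .
  obtain g where g: "g \<in> Hom T M Q" "SuspM T g = b \<cdot> e"
    using SuspM_full[OF M O(1) Comp_in_Hom[OF e(1) ab(2)]] .
  let ?f = "Neg T f" and ?g = "Neg T g"
  have fg: "?f \<in> Hom T P M" "?g \<in> Hom T M Q" using f g Neg_in_Hom by blast+
  have S: "Neg T (SuspM T ?f) = e' \<cdot> a" "Neg T (SuspM T ?g) = b \<cdot> e"
    using f g SuspM_Neg Neg_Neg SuspM_in_Hom by metis+
  have "(b \<cdot> e) \<cdot> e' = b"
    using Comp_assoc[OF e'(1) e(1) ab(2)] e'(3) Comp_Ident_right[OF ab(2)] by simp
  then have D2: "(h, e' \<cdot> a, b \<cdot> e) \<in> Dist T"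
    using TR1_iso[OF D is_triangleI[OF assms(1) Comp_in_Hom[OF ab(1) e'(1)] Comp_in_Hom[OF e(1) ab(2)]],
        of "Ident T Q" "Ident T (Susp T P)" e'] iso O e' ab assms(1)
      Ident_in_Hom[OF O(1)] Ident_in_Hom[OF O(2)] Ident_is_iso[OF O(1)] Ident_is_iso[OF O(2)]
      Comp_Ident_left[OF assms(1)] Comp_Ident_right[OF assms(1)] SuspM_Ident[OF O(1)]
      Comp_Ident_left[OF ab(2)] Comp_Ident_right[OF Comp_in_Hom[OF ab(1) e'(1)]]
    by (simp add: Hom_Dom[OF assms(1)] Hom_Dom[OF ab(1)] Hom_Dom[OF ab(2)]
        Hom_Dom[OF Comp_in_Hom[OF ab(1) e'(1)]] Hom_Dom[OF Comp_in_Hom[OF e(1) ab(2)]])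
  have t: "is_triangle T ?f ?g h" using is_triangleI fg assms(1) by blast
  have t': "is_triangle T ?g h (Neg T (SuspM T ?f))"
    using is_triangleI fg assms(1) SuspM_in_Hom Neg_in_Hom by blast
  have "(?f, ?g, h) \<in> Dist T" using TR2[OF t] TR2[OF t'] D2 S by simp
  then show ?thesis using that fg by blast
qed

text \<open>Rotating both triangles twice puts the two given components in first and second position.\<close>

lemma fill_middle_map:
  assumes "(f, g, h) \<in> Dist T" "f \<in> Hom T P M" "g \<in> Hom T M Q"
    and "(p, j, k) \<in> Dist T" "p \<in> Hom T P X" "j \<in> Hom T X Y"
    and "q \<in> Hom T Q Y" "k \<cdot> q = h"
  obtains r where "r \<in> Hom T M X" "r \<cdot> f = p" "j \<cdot> r = q \<cdot> g"
proof -
  note h = Dist_Hom3[OF assms(1-3)] and k = Dist_Hom3[OF assms(4-6)]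
  have O: "P \<in> Ob T" "M \<in> Ob T" "X \<in> Ob T" "Susp T P \<in> Ob T" using assms k Hom_Ob by blast+
  note S = assms(2,3,5,6,7)[THEN SuspM_in_Hom]
  note I = Ident_in_Hom[OF O(4)]
  have e: "Ident T (Susp T P) \<cdot> h = k \<cdot> q" using Comp_Ident_left[OF h] assms(8) by simp
  obtain d where d: "d \<in> Hom T (Susp T M) (Susp T X)"
    "d \<cdot> Neg T (SuspM T f) = Neg T (SuspM T p) \<cdot> Ident T (Susp T P)"
    "SuspM T q \<cdot> Neg T (SuspM T g) = Neg T (SuspM T j) \<cdot> d"
    using TR3_Hom[OF Dist_rotate[OF Dist_rotate[OF assms(1)]] h Neg_in_Hom[OF S(1)]
        Dist_rotate[OF Dist_rotate[OF assms(4)]] k Neg_in_Hom[OF S(3)] assms(7) I e] by metis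
  obtain r where r: "r \<in> Hom T M X" "SuspM T r = d" using SuspM_full[OF O(2,3) d(1)] .
  have "Neg T (d \<cdot> SuspM T f) = Neg T (SuspM T p)"
    using d(2) Comp_Neg_right[OF S(1) d(1)] Comp_Ident_right[OF Neg_in_Hom[OF S(3)]] by simp
  then have 1: "SuspM T (r \<cdot> f) = SuspM T p"
    using Neg_eq_iff[OF Comp_in_Hom[OF S(1) d(1)] S(3)] SuspM_Comp[OF assms(2) r(1)] r(2) by simp
  have "Neg T (SuspM T q \<cdot> SuspM T g) = Neg T (SuspM T j \<cdot> d)"
    using d(3) Comp_Neg_right[OF S(2,5)] Comp_Neg_left[OF d(1) S(4)] by simp
  then have 2: "SuspM T (j \<cdot> r) = SuspM T (q \<cdot> g)"
    using Neg_eq_iff[OF Comp_in_Hom[OF S(2,5)] Comp_in_Hom[OF d(1) S(4)]]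
      SuspM_Comp[OF r(1) assms(6)] SuspM_Comp[OF assms(3,7)] r(2) by simp
  show ?thesis
    using that[OF r(1)] SuspM_faithful[OF Comp_in_Hom[OF assms(2) r(1)] assms(5) 1]
      SuspM_faithful[OF Comp_in_Hom[OF r(1) assms(6)] Comp_in_Hom[OF assms(3,7)] 2] by blast
qed

end

section \<open>Powers of the ideal\<close>

context projective_class
begin

abbreviation Ipow :: "nat \<Rightarrow> 'm set" where
  "Ipow n \<equiv> ideal_power T \<I> n"

abbreviation Ppow :: "nat \<Rightarrow> 'o set" where
  "Ppow n \<equiv> proj_power T \<P> n"

lemma ideal_Mor: "f \<in> \<I> \<Longrightarrow> f \<in> Mor T"
  using ideal_iff by blast

lemma ideal_Hom_iff:
  assumes "f \<in> Hom T X Y"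
  shows "f \<in> \<I> \<longleftrightarrow> (\<forall>P \<in> \<P>. \<forall>p \<in> Hom T P X. f \<cdot> p = Zero T P Y)"
  using ideal_iff[of f] Hom_Mor[OF assms] Hom_Dom[OF assms] Hom_Cod[OF assms] by simp

lemma proj_Ob: "P \<in> \<P> \<Longrightarrow> P \<in> Ob T"
  using proj_iff by blast

lemma ideal_Comp_left:
  assumes "f \<in> \<I>" "f \<in> Hom T X Y" "g \<in> Hom T Y Z"
  shows "g \<cdot> f \<in> \<I>"
proof -
  have "(g \<cdot> f) \<cdot> p = Zero T P Z" if "P \<in> \<P>" "p \<in> Hom T P X" for P p
  proof -
    have "f \<cdot> p = Zero T P Y" using assms(1) that ideal_Hom_iff[OF assms(2)] by blast
    then show ?thesis
      using Comp_assoc[OF that(2) assms(2,3)] Comp_Zero_right[OF assms(3) proj_Ob[OF that(1)]] by simp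
  qed
  then show ?thesis using ideal_Hom_iff[OF Comp_in_Hom[OF assms(2,3)]] by blast
qed

lemma ideal_Comp_right:
  assumes "f \<in> Hom T X Y" "g \<in> \<I>" "g \<in> Hom T Y Z"
  shows "g \<cdot> f \<in> \<I>"
proof -
  have "(g \<cdot> f) \<cdot> p = Zero T P Z" if "P \<in> \<P>" "p \<in> Hom T P X" for P p
    using Comp_assoc[OF that(2) assms(1,3)] Comp_in_Hom[OF that(2) assms(1)]
      assms(2) that(1) ideal_Hom_iff[OF assms(3)] by simp
  then show ?thesis using ideal_Hom_iff[OF Comp_in_Hom[OF assms(1,3)]] by blast
qed

lemma ideal_power_Mor: "u \<in> Ipow n \<Longrightarrow> u \<in> Mor T"
proof (induction n arbitrary: u rule: induct_nat_012)
  case (ge2 n)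
  from ge2.prems obtain f g where
    "f \<in> Ipow (Suc n)" "g \<in> \<I>" "Cod T f = Dom T g" "u = g \<cdot> f"
    by auto
  then have "f \<in> Mor T" "g \<in> Mor T" "Cod T f = Dom T g" "u = g \<cdot> f"
    using ge2.IH ideal_Mor by blast+
  then show ?case using Comp_in_Hom[of f _ _ g] Mor_in_Hom Hom_Mor by metis
qed (use ideal_Mor in auto)

text \<open>The recursion defining the powers starts at exponent one. Since \<open>\<I>\<close> is an ideal, the recursion
  step is also valid from exponent zero, so induction needs only one step case.\<close>

lemma ideal_power_Suc_iff:
  "u \<in> Ipow (Suc n) \<longleftrightarrow>
    (\<exists>A B D f g. f \<in> Ipow n \<and> g \<in> \<I> \<and> f \<in> Hom T A B \<and> g \<in> Hom T B D \<and> u = g \<cdot> f)"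
proof (cases n)
  case 0
  have "\<exists>A B D f g. f \<in> Mor T \<and> g \<in> \<I> \<and> f \<in> Hom T A B \<and> g \<in> Hom T B D \<and> u = g \<cdot> f" if "u \<in> \<I>"
    using Mor_in_Hom[OF ideal_Mor[OF that]] that Comp_Ident_right Ident_in_Hom Hom_Ob Hom_Mor by metis
  then show ?thesis using 0 ideal_Comp_right by auto
next
  case (Suc n')
  have "f \<in> Ipow n \<and> g \<in> \<I> \<and> Cod T f = Dom T g \<longleftrightarrow>
      f \<in> Ipow n \<and> g \<in> \<I> \<and> (\<exists>A B D. f \<in> Hom T A B \<and> g \<in> Hom T B D)" for f g
    using ideal_power_Mor ideal_Mor by (auto simp: Hom_def)
  then show ?thesis using Suc by simp blast
qed

lemma ideal_power_Comp_left:
  assumes "f \<in> Ipow n" "f \<in> Hom T X Y" "g \<in> Hom T Y Z"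
  shows "g \<cdot> f \<in> Ipow n"
proof (cases n)
  case 0
  then show ?thesis using Comp_in_Hom[OF assms(2,3)] Hom_Mor by simp
next
  case (Suc n')
  then obtain A B D a b where ab: "a \<in> Ipow n'" "b \<in> \<I>" "a \<in> Hom T A B" "b \<in> Hom T B D" "f = b \<cdot> a"
    using assms(1) ideal_power_Suc_iff by blast
  have D: "D = Y" "A = X"
    using Comp_in_Hom[OF ab(3,4)] ab(5) assms(2) by (auto simp: Hom_def)
  have "g \<cdot> f = (g \<cdot> b) \<cdot> a" "g \<cdot> b \<in> \<I>" "g \<cdot> b \<in> Hom T B Z"
    using Comp_assoc[OF ab(3,4)] ideal_Comp_left[OF ab(2,4)] Comp_in_Hom[OF ab(4)] assms(3) ab(5) D by auto
  then show ?thesis using Suc ideal_power_Suc_iff ab(1,3) by blast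
qed

lemma ideal_power_Comp_right:
  assumes "g \<in> Ipow n" "f \<in> Hom T X Y" "g \<in> Hom T Y Z"
  shows "g \<cdot> f \<in> Ipow n"
  using assms
proof (induction n arbitrary: g Z)
  case 0
  then show ?case using Comp_in_Hom Hom_Mor by simp metis
next
  case (Suc n)
  then obtain A B D a b where ab: "a \<in> Ipow n" "b \<in> \<I>" "a \<in> Hom T A B" "b \<in> Hom T B D" "g = b \<cdot> a"
    using ideal_power_Suc_iff by blast
  have D: "A = Y"
    using Comp_in_Hom[OF ab(3,4)] ab(5) Suc.prems(3) by (auto simp: Hom_def)
  have a: "a \<cdot> f \<in> Ipow n" "a \<cdot> f \<in> Hom T X B"
    using Suc.IH[OF ab(1) Suc.prems(2)] Comp_in_Hom[OF Suc.prems(2)] ab(3) D by auto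
  have "g \<cdot> f = b \<cdot> (a \<cdot> f)" using Comp_assoc[OF Suc.prems(2) _ ab(4)] ab(3,5) D by auto
  then show ?case using ideal_power_Suc_iff a ab(2,4) by blast
qed

lemma ideal_power_add_Comp:
  assumes "f \<in> Ipow a" "g \<in> Ipow b" "f \<in> Hom T X Y" "g \<in> Hom T Y Z"
  shows "g \<cdot> f \<in> Ipow (a + b)"
  using assms
proof (induction b arbitrary: g Z)
  case 0
  then show ?case using ideal_power_Comp_left by simp
next
  case (Suc b)
  then obtain A B D c d where cd: "c \<in> Ipow b" "d \<in> \<I>" "c \<in> Hom T A B" "d \<in> Hom T B D" "g = d \<cdot> c"
    using ideal_power_Suc_iff by blast
  have D: "A = Y"
    using Comp_in_Hom[OF cd(3,4)] cd(5) Suc.prems(4) by (auto simp: Hom_def)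
  have c: "c \<cdot> f \<in> Ipow (a + b)" "c \<cdot> f \<in> Hom T X B"
    using Suc.IH[OF Suc.prems(1) cd(1) Suc.prems(3)] Comp_in_Hom[OF Suc.prems(3)] cd(3) D by auto
  have "g \<cdot> f = d \<cdot> (c \<cdot> f)" using Comp_assoc[OF Suc.prems(3) _ cd(4)] cd(3,5) D by auto
  then show ?case using ideal_power_Suc_iff c cd(2,4) by (metis add_Suc_right)
qed

lemma ideal_power_split:
  assumes "u \<in> Ipow (a + b)" "u \<in> Hom T X Z"
  obtains Y f g where "f \<in> Ipow a" "g \<in> Ipow b" "f \<in> Hom T X Y" "g \<in> Hom T Y Z" "u = g \<cdot> f"
  using assms
proof (induction b arbitrary: u Z thesis)
  case 0
  have "Ident T Z \<in> Hom T Z Z" using Ident_in_Hom Hom_Ob[OF 0(3)] by blast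
  then show ?case
    using 0(1)[of u "Ident T Z" Z] 0(2,3) Hom_Mor Comp_Ident_left[OF 0(3)] by simp
next
  case (Suc b)
  then obtain A B D c d where cd: "c \<in> Ipow (a + b)" "d \<in> \<I>" "c \<in> Hom T A B" "d \<in> Hom T B D" "u = d \<cdot> c"
    using ideal_power_Suc_iff by (metis add_Suc_right)
  have D: "A = X" "D = Z"
    using Comp_in_Hom[OF cd(3,4)] cd(5) Suc.prems(3) by (auto simp: Hom_def)
  obtain Y f g where fg: "f \<in> Ipow a" "g \<in> Ipow b" "f \<in> Hom T X Y" "g \<in> Hom T Y B" "c = g \<cdot> f"
    using Suc.IH[OF _ cd(1)] cd(3) D by blast
  have "u = (d \<cdot> g) \<cdot> f" using Comp_assoc[OF fg(3,4) cd(4)] cd(5) fg(5) by simp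
  moreover have "d \<cdot> g \<in> Ipow (Suc b)" "d \<cdot> g \<in> Hom T Y Z"
    using ideal_power_Suc_iff fg cd D Comp_in_Hom by blast+
  ultimately show ?case using Suc.prems(1) fg(1,3) by blast
qed

lemma ideal_power_antimono:
  assumes "a \<le> b" "u \<in> Ipow b"
  shows "u \<in> Ipow a"
proof -
  have u: "u \<in> Hom T (Dom T u) (Cod T u)" using ideal_power_Mor[OF assms(2)] Mor_in_Hom by blast
  have "u \<in> Ipow (a + (b - a))" using assms by simp
  then show ?thesis using ideal_power_split[OF _ u] ideal_power_Comp_left by metis
qed

lemma retract_proj:
  assumes "is_retract T X P" "P \<in> \<P>"
  shows "X \<in> \<P>"
proof -
  obtain i r where ir: "i \<in> Hom T X P" "r \<in> Hom T P X" "r \<cdot> i = Ident T X"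
    using assms(1) by (auto simp: is_retract_def)
  have X: "X \<in> Ob T" using Hom_Ob ir by blast
  have "f \<cdot> p = Zero T X (Cod T f)" if f: "f \<in> \<I>" "p \<in> Hom T X (Dom T f)" for f p
  proof -
    have F: "f \<in> Hom T (Dom T f) (Cod T f)" using Mor_in_Hom ideal_Mor f by blast
    have fp: "f \<cdot> p \<in> Hom T X (Cod T f)" using Comp_in_Hom[OF f(2) F] .
    have "(f \<cdot> p) \<cdot> r = Zero T P (Cod T f)"
      using Comp_assoc[OF ir(2) f(2) F] Comp_in_Hom[OF ir(2) f(2)] f(1) ideal_Hom_iff[OF F] assms(2)
      by simp
    then have "((f \<cdot> p) \<cdot> r) \<cdot> i = Zero T X (Cod T f)"
      using Comp_Zero_left[OF ir(1)] Hom_Ob[OF F] by simp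
    then show ?thesis using Comp_assoc[OF ir(1,2) fp] ir(3) Comp_Ident_right[OF fp] by simp
  qed
  then show ?thesis using proj_iff X by blast
qed

text \<open>Every object of \<open>\<P>\<close> is isomorphic to a suspension, which by desuspension closure is
  the suspension of an object of \<open>\<P>\<close>. So, up to isomorphism, a map from an object of \<open>\<P>\<close> to
  \<open>\<Sigma>X\<close> is the suspension of a map from an object of \<open>\<P>\<close> to \<open>X\<close>, and this one is killed by \<open>f\<close>.\<close>

lemma SuspM_ideal:
  assumes "f \<in> \<I>"
  shows "SuspM T f \<in> \<I>"
proof -
  define X Y where "X = Dom T f" and "Y = Cod T f"
  have f: "f \<in> Hom T X Y" using Mor_in_Hom[OF ideal_Mor[OF assms]] by (simp add: X_def Y_def)
  have X: "X \<in> Ob T" "Y \<in> Ob T" using f Hom_Ob by blast+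
  have F: "SuspM T f \<in> Hom T (Susp T X) (Susp T Y)" using f by (rule SuspM_in_Hom)
  have "SuspM T f \<cdot> p = Zero T P (Susp T Y)" if P: "P \<in> \<P>" "p \<in> Hom T P (Susp T X)" for P p
  proof -
    obtain P' e where P': "P' \<in> Ob T" and e: "e \<in> Hom T (Susp T P') P" "is_iso T e"
      using Susp_essentially_surjective[OF proj_Ob[OF P(1)]] by blast
    obtain e' where e': "e' \<in> Hom T P (Susp T P')" "e' \<cdot> e = Ident T (Susp T P')" "e \<cdot> e' = Ident T P"
      using e unfolding is_iso_def by (auto simp: Hom_Dom[OF e(1)] Hom_Cod[OF e(1)])
    have "is_retract T (Susp T P') P"
      unfolding is_retract_def using e e' Hom_Ob by blast
    then have PP: "P' \<in> \<P>" using retract_proj P(1) desuspension_closed_proj P' by blast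
    obtain w where w: "w \<in> Hom T P' X" "SuspM T w = p \<cdot> e"
      using SuspM_full[OF P' X(1) Comp_in_Hom[OF e(1) P(2)]] .
    have "f \<cdot> w = Zero T P' Y" using assms w(1) PP ideal_Hom_iff[OF f] by blast
    then have "SuspM T f \<cdot> (p \<cdot> e) = Zero T (Susp T P') (Susp T Y)"
      using SuspM_Comp[OF w(1) f] w(2) SuspM_Zero[OF P' X(2)] by simp
    then have z: "(SuspM T f \<cdot> p) \<cdot> e = Zero T (Susp T P') (Susp T Y)"
      using Comp_assoc[OF e(1) P(2) F] by simp
    have fp: "SuspM T f \<cdot> p \<in> Hom T P (Susp T Y)" using Comp_in_Hom[OF P(2) F] .
    have "SuspM T f \<cdot> p = ((SuspM T f \<cdot> p) \<cdot> e) \<cdot> e'"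
      using Comp_assoc[OF e'(1) e(1) fp] e'(3) Comp_Ident_right[OF fp] by simp
    then show ?thesis using z Comp_Zero_left[OF e'(1)] Susp_closed[OF X(2)] by simp
  qed
  then show ?thesis using ideal_Hom_iff[OF F] by blast
qed

lemma SuspM_ideal_power: "u \<in> Ipow n \<Longrightarrow> SuspM T u \<in> Ipow n"
proof (induction n arbitrary: u)
  case 0
  then show ?case using SuspM_in_Hom Mor_in_Hom Hom_Mor by simp metis
next
  case (Suc n)
  then obtain A B D c d where cd: "c \<in> Ipow n" "d \<in> \<I>" "c \<in> Hom T A B" "d \<in> Hom T B D" "u = d \<cdot> c"
    using ideal_power_Suc_iff by blast
  then show ?case
    using ideal_power_Suc_iff Suc.IH[OF cd(1)] SuspM_ideal[OF cd(2)] SuspM_Comp[OF cd(3,4)]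
      SuspM_in_Hom[OF cd(3)] SuspM_in_Hom[OF cd(4)] by metis
qed

section \<open>Length is detected by powers of the ideal\<close>

definition annihilated :: "nat \<Rightarrow> 'o \<Rightarrow> bool" where
  "annihilated n X \<longleftrightarrow> (\<forall>V. \<forall>u \<in> Hom T X V. u \<in> Ipow n \<longrightarrow> u = Zero T X V)"

lemma annihilatedD: "annihilated n X \<Longrightarrow> u \<in> Hom T X V \<Longrightarrow> u \<in> Ipow n \<Longrightarrow> u = Zero T X V"
  by (auto simp: annihilated_def)

lemma retract_annihilated:
  assumes "is_retract T X M" "annihilated n M"
  shows "annihilated n X"
  unfolding annihilated_def
proof (intro allI ballI impI)
  fix V u assume u: "u \<in> Hom T X V" "u \<in> Ipow n"
  obtain i r where ir: "i \<in> Hom T X M" "r \<in> Hom T M X" "r \<cdot> i = Ident T X"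
    using assms(1) by (auto simp: is_retract_def)
  have "u \<cdot> r = Zero T M V"
    using annihilatedD[OF assms(2) Comp_in_Hom[OF ir(2) u(1)]] ideal_power_Comp_right[OF u(2) ir(2) u(1)] .
  then have "u \<cdot> (r \<cdot> i) = Zero T X V"
    using Comp_assoc[OF ir(1,2) u(1)] Comp_Zero_left[OF ir(1)] Hom_Ob[OF u(1)] by simp
  then show "u = Zero T X V" using ir(3) Comp_Ident_right[OF u(1)] by simp
qed

lemma proj_power_Ob: "X \<in> Ppow n \<Longrightarrow> X \<in> Ob T"
  by (cases "(T, \<P>, n)" rule: proj_power.cases) (auto simp: zero_objects_def proj_Ob is_retract_def)

text \<open>The ghost lemma. For \<open>P \<rightarrow> M \<rightarrow> Q\<close>, the first factor of a map in \<open>\<I>\<^sup>n\<close> out of \<open>M\<close> kills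
  \<open>P\<close> and so factors through \<open>Q\<close>; the other \<open>n - 1\<close> factors then kill what is left.\<close>

lemma proj_power_annihilated: "X \<in> Ppow n \<Longrightarrow> annihilated n X"
proof (induction n arbitrary: X rule: induct_nat_012)
  case 0
  then show ?case using Hom_from_zero_object by (simp add: annihilated_def)
next
  case 1
  have X: "X \<in> \<P>" "X \<in> Ob T" using 1 proj_Ob by auto
  have "u = Zero T X V" if "u \<in> Hom T X V" "u \<in> \<I>" for u V
    using ideal_Hom_iff[OF that(1)] that(2) X Ident_in_Hom Comp_Ident_right[OF that(1)] by metis
  then show ?case by (simp add: annihilated_def)
next
  case (ge2 n)
  then obtain M P Q f g where M: "is_retract T X M" "P \<in> \<P>" "Q \<in> Ppow (Suc n)"
    "f \<in> Hom T P M" "g \<in> Hom T M Q" "cofibre_sequence T f g"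
    by auto
  obtain h where D: "(f, g, h) \<in> Dist T" using M(6) by (auto simp: cofibre_sequence_def)
  have "u = Zero T M V" if u: "u \<in> Hom T M V" "u \<in> Ipow (Suc (Suc n))" for V u
  proof -
    have "u \<in> Ipow (1 + Suc n)" using u(2) by simp
    then obtain B a b where ab: "a \<in> Ipow 1" "b \<in> Ipow (Suc n)" "a \<in> Hom T M B" "b \<in> Hom T B V" "u = b \<cdot> a"
      using ideal_power_split u(1) by metis
    have "a \<cdot> f = Zero T P B" using ideal_Hom_iff[OF ab(3)] ab(1) M(2,4) by simp
    then obtain a' where a': "a' \<in> Hom T Q B" "a' \<cdot> g = a"
      using weak_cokernel[OF D M(4,5) ab(3)] by blast
    have "b \<cdot> a' = Zero T Q V"
      using annihilatedD[OF ge2.IH(2)[OF M(3)] Comp_in_Hom[OF a'(1) ab(4)]]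
        ideal_power_Comp_right[OF ab(2) a'(1) ab(4)] by blast
    then show ?thesis
      using Comp_assoc[OF M(5) a'(1) ab(4)] a'(2) ab(5) Comp_Zero_left[OF M(5)] Hom_Ob[OF u(1)] by simp
  qed
  then have "annihilated (Suc (Suc n)) M" by (simp add: annihilated_def del: ideal_power.simps)
  then show ?case using retract_annihilated M(1) by blast
qed

lemma retract_proj_power:
  assumes "is_retract T X M" "M \<in> Ppow n"
  shows "X \<in> Ppow n"
proof -
  consider (0) "n = 0" | (1) "n = 1" | (ge2) n' where "n = Suc (Suc n')"
    by (metis One_nat_def not0_implies_Suc)
  then show ?thesis
  proof cases
    case 0
    have M: "annihilated 0 M" using proj_power_annihilated assms(2) 0 by blast
    have X: "X \<in> Ob T" using assms(1) by (auto simp: is_retract_def)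
    have "Ident T X = Zero T X X"
      using annihilatedD[OF retract_annihilated[OF assms(1) M] Ident_in_Hom[OF X]]
        Hom_Mor[OF Ident_in_Hom[OF X]] by simp
    then show ?thesis using 0 X by (simp add: zero_objects_iff)
  next
    case 1
    then show ?thesis using assms retract_proj by simp
  next
    case ge2
    then show ?thesis using assms is_retract_trans by simp blast
  qed
qed

text \<open>Given \<open>P \<rightarrow> X \<rightarrow> Y\<close> with \<open>X \<rightarrow> Y\<close> in \<open>\<I>\<close>, and an approximation \<open>q: Q \<rightarrow> Y\<close> of the next lower
  order, let \<open>M\<close> be the extension of \<open>Q\<close> by \<open>P\<close> classified by \<open>Q \<rightarrow> Y \<rightarrow> \<Sigma>P\<close>, with the induced map
  \<open>r: M \<rightarrow> X\<close>. A map \<open>u\<close> that kills \<open>r\<close> also kills \<open>P\<close> and so factors as \<open>u' \<cdot> j\<close> through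
  \<open>j: X \<rightarrow> Y\<close>. The factor \<open>u'\<close> can be corrected by a map through \<open>k: Y \<rightarrow> \<Sigma>P\<close>, which
  does not affect \<open>u' \<cdot> j\<close>, so that it kills \<open>q\<close>
  and hence lies in the power of \<open>\<I>\<close> that \<open>q\<close> detects.\<close>

lemma proj_approximation:
  assumes "X \<in> Ob T"
  obtains W q where "W \<in> Ppow n" "q \<in> Hom T W X"
    "\<And>V u. u \<in> Hom T X V \<Longrightarrow> u \<cdot> q = Zero T W V \<Longrightarrow> u \<in> Ipow n"
  using assms
proof (induction n arbitrary: X thesis rule: induct_nat_012)
  case 0
  obtain N where N: "N \<in> zero_objects T" using zero_object_exists by blast
  have "Zero T N X \<in> Hom T N X" using Zero_in_Hom N 0(2) zero_objects_iff by blast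
  then show ?case using 0(1)[of N "Zero T N X"] N Hom_Mor by simp
next
  case 1
  obtain P p f where P: "P \<in> \<P>" "p \<in> Hom T P X" "f \<in> \<I>" "cofibre_sequence T p f"
    using enough_projectives[OF 1(2)] by blast
  obtain h where D: "(p, f, h) \<in> Dist T" using P(4) by (auto simp: cofibre_sequence_def)
  obtain Y where f: "f \<in> Hom T X Y"
    using Dist_is_triangle[OF D] P(2) by (auto simp: is_triangle_def Hom_def)
  have "u \<in> \<I>" if "u \<in> Hom T X V" "u \<cdot> p = Zero T P V" for u V
    using weak_cokernel[OF D P(2) f that] ideal_Comp_left[OF P(3) f] by metis
  then show ?case using 1(1)[of P p] P by simp
next
  case (ge2 n)
  obtain P p j where P: "P \<in> \<P>" "p \<in> Hom T P X" "j \<in> \<I>" "cofibre_sequence T p j"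
    using enough_projectives[OF ge2.prems(2)] by blast
  obtain k where D: "(p, j, k) \<in> Dist T" using P(4) by (auto simp: cofibre_sequence_def)
  obtain Y where j: "j \<in> Hom T X Y"
    using Dist_is_triangle[OF D] P(2) by (auto simp: is_triangle_def Hom_def)
  note k = Dist_Hom3[OF D P(2) j]
  obtain Q q where Q: "Q \<in> Ppow (Suc n)" "q \<in> Hom T Q Y"
    "\<And>V u. u \<in> Hom T Y V \<Longrightarrow> u \<cdot> q = Zero T Q V \<Longrightarrow> u \<in> Ipow (Suc n)"
    using ge2.IH(2)[of Y] Hom_Ob[OF j] by blast
  obtain M f g where M: "f \<in> Hom T P M" "g \<in> Hom T M Q" "(f, g, k \<cdot> q) \<in> Dist T"
    using complete_third_map[OF Comp_in_Hom[OF Q(2) k] proj_Ob[OF P(1)]] .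
  obtain r where r: "r \<in> Hom T M X" "r \<cdot> f = p" "j \<cdot> r = q \<cdot> g"
    using fill_middle_map[OF M(3,1,2) D P(2) j Q(2)] by blast
  have MO: "M \<in> Ob T" using M Hom_Ob by blast
  have "cofibre_sequence T f g" using M(3) by (auto simp: cofibre_sequence_def)
  then have MP: "M \<in> Ppow (Suc (Suc n))"
    using is_retract_refl[OF MO] P(1) Q(1) M(1,2) by simp blast
  have "u \<in> Ipow (Suc (Suc n))" if u: "u \<in> Hom T X V" "u \<cdot> r = Zero T M V" for u V
  proof -
    have V: "V \<in> Ob T" using u Hom_Ob by blast
    have "u \<cdot> p = Zero T P V"
      using Comp_assoc[OF M(1) r(1) u(1)] r(2) u(2) Comp_Zero_left[OF M(1) V] by simp
    then obtain u' where u': "u' \<in> Hom T Y V" "u' \<cdot> j = u" using weak_cokernel[OF D P(2) j u(1)] by blast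
    have "(u' \<cdot> q) \<cdot> g = Zero T M V"
      using Comp_assoc[OF M(2) Q(2) u'(1)] r(3) Comp_assoc[OF r(1) j u'(1)] u'(2) u(2) by simp
    \<comment> \<open>The obstruction \<open>u' \<cdot> q\<close> vanishes on \<open>M\<close>, so it factors through the classifying map of \<open>M\<close>.\<close>
    then obtain v where v: "v \<in> Hom T (Susp T P) V" "v \<cdot> (k \<cdot> q) = u' \<cdot> q"
      using weak_cokernel_rotated[OF M(3,1,2) Comp_in_Hom[OF Q(2) u'(1)]] by blast
    define d where "d = u' \<boxplus> Neg T (v \<cdot> k)"
    have vk: "v \<cdot> k \<in> Hom T Y V" using Comp_in_Hom[OF k v(1)] .
    have d: "d \<in> Hom T Y V" unfolding d_def using Add_in_Hom[OF u'(1) Neg_in_Hom[OF vk]] .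
    have "d \<cdot> q = Zero T Q V"
      unfolding d_def using diff_Comp_Zero[OF Q(2) u'(1) vk] v(2) Comp_assoc[OF Q(2) k v(1)] by simp
    then have dI: "d \<in> Ipow (Suc n)" using Q(3) d by blast
    have "(v \<cdot> k) \<cdot> j = Zero T X V"
      using Comp_assoc[OF j k v(1)] Dist_Comp_Zero[OF Dist_rotate[OF D] j k]
        Comp_Zero_right[OF v(1)] Hom_Ob[OF j] by simp
    then have "d \<cdot> j = u"
      unfolding d_def using Comp_Add_left[OF j u'(1) Neg_in_Hom[OF vk]] Comp_Neg_left[OF j vk]
        Neg_Zero[OF _ V] Hom_Ob[OF j] u'(2) Add_Zero[OF u(1)] by simp
    moreover have "j \<in> Ipow 1" using P(3) by simp
    ultimately have "u \<in> Ipow (1 + Suc n)" using ideal_power_add_Comp[OF _ dI j d] by blast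
    then show ?thesis by simp
  qed
  then show ?case using ge2.prems(1)[OF MP r(1)] by blast
qed

lemma proj_power_iff_annihilated:
  assumes "X \<in> Ob T"
  shows "X \<in> Ppow n \<longleftrightarrow> annihilated n X"
proof
  assume a: "annihilated n X"
  obtain W q where W: "W \<in> Ppow n" "q \<in> Hom T W X"
    "\<And>V u. u \<in> Hom T X V \<Longrightarrow> u \<cdot> q = Zero T W V \<Longrightarrow> u \<in> Ipow n"
    using proj_approximation[OF assms] by blast
  obtain f h where D: "(q, f, h) \<in> Dist T" using TR1_complete Hom_Mor[OF W(2)] by blast
  obtain Y where f: "f \<in> Hom T X Y"
    using Dist_is_triangle[OF D] W(2) by (auto simp: is_triangle_def Hom_def)
  have "f \<in> Ipow n" using W(3)[OF f] Dist_Comp_Zero[OF D W(2) f] by blast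
  then have "f \<cdot> Ident T X = Zero T X Y"
    using annihilatedD[OF a f] Comp_Ident_right[OF f] by simp
  then obtain w where "w \<in> Hom T X W" "q \<cdot> w = Ident T X"
    using weak_kernel[OF D W(2) f Ident_in_Hom[OF assms]] by blast
  then have "is_retract T X W"
    unfolding is_retract_def using assms W(2) Hom_Ob by blast
  then show "X \<in> Ppow n" using W(1) retract_proj_power by blast
qed (rule proj_power_annihilated)

lemma len_annihilated:
  assumes "len T \<P> X = enat k"
  shows "annihilated k X" and "X \<in> Ob T" and "\<And>n. annihilated n X \<Longrightarrow> k \<le> n"
proof -
  have ex: "\<exists>n. X \<in> Ppow n" and k: "k = (LEAST n. X \<in> Ppow n)"
    using assms by (auto simp: len_def split: if_splits)
  have "X \<in> Ppow k" using LeastI_ex[OF ex] k by simp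
  then show a: "annihilated k X" and o: "X \<in> Ob T"
    using proj_power_annihilated proj_power_Ob by blast+
  show "k \<le> n" if "annihilated n X" for n
    using that proj_power_iff_annihilated[OF o] k Least_le by metis
qed

text \<open>If a map in \<open>\<I>\<^sup>n\<^sup>+\<^sup>i\<close> out of \<open>X\<close> is split after its first \<open>n\<close> factors, then by hypothesis that
  part lies in \<open>\<I>\<^sup>n\<^sup>+\<^sup>1\<close>, so the whole map gains one factor. Iterating reaches \<open>\<I>\<^sup>l\<close>.\<close>

lemma annihilated_if_power_stagnates:
  assumes "annihilated l X"
    and "\<And>V u. u \<in> Hom T X V \<Longrightarrow> u \<in> Ipow n \<Longrightarrow> u \<in> Ipow (Suc n)"
  shows "annihilated n X"
proof -
  have "u \<in> Ipow (n + i)" if "u \<in> Hom T X V" "u \<in> Ipow n" for u V i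
    using that
  proof (induction i)
    case (Suc i)
    then obtain B a b where ab: "a \<in> Ipow n" "b \<in> Ipow i" "a \<in> Hom T X B" "b \<in> Hom T B V" "u = b \<cdot> a"
      using ideal_power_split by metis
    then show ?case
      using ideal_power_add_Comp[OF assms(2)[OF ab(3,1)] ab(2,3,4)] by simp
  qed simp
  then have "u \<in> Ipow l" if "u \<in> Hom T X V" "u \<in> Ipow n" for u V
    using that ideal_power_antimono[of l "n + l" u] by simp
  then show ?thesis using assms(1) unfolding annihilated_def by blast
qed

section \<open>Lengths in a triangle\<close>

text \<open>If \<open>n < m\<close>, then maps in \<open>\<I>\<^sup>n\<close> out of \<open>Z\<close> factor through \<open>\<gamma>\<close> and gain a factor in \<open>\<I>\<close>,
  so the powers of \<open>\<I>\<close> out of \<open>Z\<close> stagnate before \<open>l\<close>.\<close>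

lemma connecting_map_power_le_middle_length:
  assumes D: "(\<alpha>, \<beta>, \<gamma>) \<in> Dist T"
    and Hom: "\<alpha> \<in> Hom T X Y" "\<beta> \<in> Hom T Y Z"
    and len: "len T \<P> Y = enat n" "len T \<P> Z = enat l"
    and \<gamma>: "\<gamma> \<in> Ipow m" "m \<le> l"
  shows "m \<le> n"
proof (rule ccontr)
  assume "\<not> m \<le> n"
  then have nm: "Suc n \<le> m" by simp
  note h = Dist_Hom3[OF D Hom]
  have "u \<in> Ipow (Suc n)" if u: "u \<in> Hom T Z V" "u \<in> Ipow n" for u V
  proof -
    have "u \<cdot> \<beta> = Zero T Y V"
      using annihilatedD[OF len_annihilated(1)[OF len(1)] Comp_in_Hom[OF Hom(2) u(1)]]
        ideal_power_Comp_right[OF u(2) Hom(2) u(1)] by blast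
    then obtain v where "v \<in> Hom T (Susp T X) V" "v \<cdot> \<gamma> = u"
      using weak_cokernel_rotated[OF D Hom u(1)] by blast
    then have "u \<in> Ipow m" using ideal_power_Comp_left[OF \<gamma>(1) h] by blast
    then show ?thesis using ideal_power_antimono nm by blast
  qed
  then have "annihilated n Z"
    using annihilated_if_power_stagnates len_annihilated(1)[OF len(2)] by blast
  then have "l \<le> n" using len_annihilated(3)[OF len(2)] by blast
  then show False using nm \<gamma>(2) by simp
qed

text \<open>The first \<open>l - m\<close> factors complete \<open>\<gamma>\<close> to an \<open>l\<close>-fold composite, which vanishes on \<open>Z\<close>; so they
  extend from \<open>X\<close> to \<open>Y\<close>; the remaining \<open>n\<close> factors vanish on \<open>Y\<close>.\<close>

lemma first_length_le:
  assumes D: "(\<alpha>, \<beta>, \<gamma>) \<in> Dist T"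
    and Hom: "\<alpha> \<in> Hom T X Y" "\<beta> \<in> Hom T Y Z"
    and len: "len T \<P> X = enat k" "len T \<P> Y = enat n" "len T \<P> Z = enat l"
    and \<gamma>: "\<gamma> \<in> Ipow m" "m \<le> l"
  shows "k \<le> (l - m) + n"
proof (rule len_annihilated(3)[OF len(1)], unfold annihilated_def, intro allI ballI impI)
  note h = Dist_Hom3[OF D Hom]
  fix W u assume u: "u \<in> Hom T X W" "u \<in> Ipow ((l - m) + n)"
  obtain V a b where ab: "a \<in> Ipow (l - m)" "b \<in> Ipow n" "a \<in> Hom T X V" "b \<in> Hom T V W" "u = b \<cdot> a"
    using ideal_power_split[OF u(2,1)] .
  have "SuspM T a \<cdot> \<gamma> \<in> Ipow (m + (l - m))"
    using ideal_power_add_Comp[OF \<gamma>(1) SuspM_ideal_power[OF ab(1)] h SuspM_in_Hom[OF ab(3)]] .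
  then have "SuspM T a \<cdot> \<gamma> = Zero T Z (Susp T V)"
    using annihilatedD[OF len_annihilated(1)[OF len(3)] Comp_in_Hom[OF h SuspM_in_Hom[OF ab(3)]]] \<gamma>(2)
    by simp
  then obtain v where v: "v \<in> Hom T Y V" "v \<cdot> \<alpha> = a"
    using weak_cokernel_desuspended[OF D Hom ab(3)] by blast
  have "b \<cdot> v = Zero T Y W"
    using annihilatedD[OF len_annihilated(1)[OF len(2)] Comp_in_Hom[OF v(1) ab(4)]]
      ideal_power_Comp_right[OF ab(2) v(1) ab(4)] by blast
  then show "u = Zero T X W"
    using Comp_assoc[OF Hom(1) v(1) ab(4)] v(2) ab(5) Comp_Zero_left[OF Hom(1)] Hom_Ob[OF u(1)] by simp
qed

end

theorem lemma3p2:
  fixes T :: "('o, 'm, 'r) triangulated_scheme"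
    and \<P> :: "'o set" and \<I> :: "'m set"
    and X Y Z :: 'o and \<alpha> \<beta> \<gamma> :: 'm
    and k l m n :: nat
  assumes "projective_class T \<P> \<I>"
    and "\<alpha> \<in> Hom T X Y" and "\<beta> \<in> Hom T Y Z" and "\<gamma> \<in> Hom T Z (Susp T X)"
    and "(\<alpha>, \<beta>, \<gamma>) \<in> Dist T"
    and "len T \<P> X = enat k" and "len T \<P> Y = enat n" and "len T \<P> Z = enat l"
    and "\<gamma> \<in> ideal_power T \<I> m" and "m \<le> l"
  shows "len T \<P> Y = enat n \<and> int n \<ge> max (int k - int l + int m) (int m)"
proof -
  interpret projective_class T \<P> \<I> by fact
  have "m \<le> n"
    using connecting_map_power_le_middle_length[OF assms(5,2,3,7,8,9,10)] .
  moreover have "k \<le> (l - m) + n"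
    using first_length_le[OF assms(5,2,3,6,7,8,9,10)] .
  ultimately show ?thesis using assms(7,10) by simp
qed

end
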